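(* Let $G$ be a finite group, $S\subseteq G$ a symmetric subset, $\alpha_0>0$, and let $\hat G=\{\rho_1,\dots,\rho_L\}$ be a maximal set of inequivalent irreducible (complex) representations of $G$, with $d_\rho$ the dimension of $\rho$. Let $M(\rho)=\sum_{g\in S}\rho(g)$, and for each $i$ let $v^i_j$ ($1\le j\le d_{\rho_i}$) be the $j$th eigenvector of $M(\rho_i)$, with eigenvalue $\nu^i_j$. Let $H^i_{jk}$ be the $d_{\rho_i}\times d_{\rho_i}$ zero matrix with its $k$th column replaced by $v^i_j$, and define the function $f^i_{jk}$ on $\hat G$, with $f^i_{jk}(\rho)$ a $d_\rho\times d_\rho$ complex matrix, by $$f^i_{jk}(\rho_i)=H^i_{jk},\qquad f^i_{jk}(\rho)=0\ \text{ for }\rho\in\hat G,\ \rho\ne\rho_i.$$ Then $f^i_{jk}$ is an eigenfunction of the operator $\hat H_0$ with corresponding eigenvalue $$\lambda^i_{jk}=|S|+\alpha_0-\nu^i_j$$ for all $i=1,\dots,L$ and $1\le j,k\le d_{\rho_i}$.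
   Context: $S$ symmetric means $g\in S\Rightarrow g^{-1}\in S$. On the Cayley graph $X(G,S)$ (vertex set $G$, edges $(g,h)$ with $gh^{-1}\in S$), the diffusion operator is $H_0[f]=\big((|S|+\alpha_0)\chi_e-\chi_S\big)*f$, where $\chi_e$ and $\chi_S$ are the characteristic functions of the identity element and of $S$, and $(f*h)(g)=\sum_{r\in G}f(r^{-1})h(rg)$. The Fourier transform of $f:G\to\mathbb{C}$ is $\mathcal{F}[f](\rho)=\sum_{g\in G}f(g)\rho(g)$, a $d_\rho\times d_\rho$ matrix for each $\rho\in\hat G$ (each representation realized by matrices). The operator $\hat H_0$ is the Fourier transform of $H_0$; it acts on functions $F$ assigning to each $\rho\in\hat G$ a matrix $F(\rho)\in\mathbb{C}^{d_\rho\times d_\rho}$ by $$\hat H_0[F](\rho)=(|S|+\alpha_0)F(\rho)-\sum_{g\in S}\rho(g)F(\rho).$$ For each $i$ the matrix $M(\rho_i)$ is diagonalizable, and $v^i_1,\dots,v^i_{d_{\rho_i}}$ denotes a basis of its eigenvectors. *)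

theory Defs
  imports
    "HOL-Library.Indicator_Function"
    "Jordan_Normal_Form.VS_Connect"
    "Jordan_Normal_Form.Char_Poly"
begin

abbreviation cmat_ring :: "nat \<Rightarrow> complex mat ring" where
  "cmat_ring d \<equiv> ring_mat TYPE(complex) d ()"

text \<open>
  A matrix representation is a function on the underlying type of the group; only its values on
  the carrier matter. Its dimension is read off from the matrix of the identity element.
\<close>

definition rep_dim :: "('g, 'm) monoid_scheme \<Rightarrow> ('g \<Rightarrow> complex mat) \<Rightarrow> nat" where
  "rep_dim G \<rho> = dim_row (\<rho> \<one>\<^bsub>G\<^esub>)"

definition representation :: "('g, 'm) monoid_scheme \<Rightarrow> ('g \<Rightarrow> complex mat) \<Rightarrow> bool" where
  "representation G \<rho> \<longleftrightarrow> \<rho> \<in> hom G (units_of (cmat_ring (rep_dim G \<rho>)))"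

definition irreducible_rep :: "('g, 'm) monoid_scheme \<Rightarrow> ('g \<Rightarrow> complex mat) \<Rightarrow> bool" where
  "irreducible_rep G \<rho> \<longleftrightarrow> representation G \<rho> \<and> 0 < rep_dim G \<rho> \<and>
     (\<forall>W. subspace class_ring W (module_vec TYPE(complex) (rep_dim G \<rho>)) \<and>
          (\<forall>g\<in>carrier G. \<forall>w\<in>W. \<rho> g *\<^sub>v w \<in> W)
        \<longrightarrow> W = {0\<^sub>v (rep_dim G \<rho>)} \<or> W = carrier_vec (rep_dim G \<rho>))"

definition equivalent_reps ::
  "('g, 'm) monoid_scheme \<Rightarrow> ('g \<Rightarrow> complex mat) \<Rightarrow> ('g \<Rightarrow> complex mat) \<Rightarrow> bool" where
  "equivalent_reps G \<rho> \<sigma> \<longleftrightarrow> rep_dim G \<rho> = rep_dim G \<sigma> \<and>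
     (\<exists>T\<in>Units (cmat_ring (rep_dim G \<rho>)). \<forall>g\<in>carrier G. T * \<rho> g = \<sigma> g * T)"

definition inequivalent_irreps ::
  "('g, 'm) monoid_scheme \<Rightarrow> ('g \<Rightarrow> complex mat) set \<Rightarrow> bool" where
  "inequivalent_irreps G R \<longleftrightarrow> (\<forall>\<rho>\<in>R. irreducible_rep G \<rho>) \<and>
     (\<forall>\<rho>\<in>R. \<forall>\<sigma>\<in>R. \<rho> \<noteq> \<sigma> \<longrightarrow> \<not> equivalent_reps G \<rho> \<sigma>)"

definition maximal_inequivalent_irreps ::
  "('g, 'm) monoid_scheme \<Rightarrow> ('g \<Rightarrow> complex mat) set \<Rightarrow> bool" where
  "maximal_inequivalent_irreps G R \<longleftrightarrow> inequivalent_irreps G R \<and>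
     (\<forall>R'. inequivalent_irreps G R' \<and> R \<subseteq> R' \<longrightarrow> R' = R)"

definition symmetric_subset :: "('g, 'm) monoid_scheme \<Rightarrow> 'g set \<Rightarrow> bool" where
  "symmetric_subset G S \<longleftrightarrow> S \<subseteq> carrier G \<and> (\<forall>g\<in>S. inv\<^bsub>G\<^esub> g \<in> S)"

definition convolution ::
  "('g, 'm) monoid_scheme \<Rightarrow> ('g \<Rightarrow> complex) \<Rightarrow> ('g \<Rightarrow> complex) \<Rightarrow> 'g \<Rightarrow> complex" where
  "convolution G f h g = (\<Sum>r\<in>carrier G. f (inv\<^bsub>G\<^esub> r) * h (r \<otimes>\<^bsub>G\<^esub> g))"

definition diffusion_op ::
  "('g, 'm) monoid_scheme \<Rightarrow> 'g set \<Rightarrow> real \<Rightarrow> ('g \<Rightarrow> complex) \<Rightarrow> 'g \<Rightarrow> complex" where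
  "diffusion_op G S \<alpha>\<^sub>0 f =
     convolution G
       (\<lambda>g. (of_nat (card S) + of_real \<alpha>\<^sub>0) * indicator {\<one>\<^bsub>G\<^esub>} g - indicator S g) f"

definition fourier_transform ::
  "('g, 'm) monoid_scheme \<Rightarrow> ('g \<Rightarrow> complex) \<Rightarrow> ('g \<Rightarrow> complex mat) \<Rightarrow> complex mat" where
  "fourier_transform G f \<rho> =
     finsum (cmat_ring (rep_dim G \<rho>)) (\<lambda>g. f g \<cdot>\<^sub>m \<rho> g) (carrier G)"

definition rep_sum ::
  "('g, 'm) monoid_scheme \<Rightarrow> 'g set \<Rightarrow> ('g \<Rightarrow> complex mat) \<Rightarrow> complex mat" where
  "rep_sum G S \<rho> = finsum (cmat_ring (rep_dim G \<rho>)) \<rho> S"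

text \<open>
  The diffusion operator on the Fourier side; the lemma \<open>fourier_transform_diffusion_op\<close> below
  shows that it is the Fourier transform of \<^const>\<open>diffusion_op\<close>.
\<close>

definition diffusion_op_hat ::
  "('g, 'm) monoid_scheme \<Rightarrow> 'g set \<Rightarrow> real \<Rightarrow>
     (('g \<Rightarrow> complex mat) \<Rightarrow> complex mat) \<Rightarrow> ('g \<Rightarrow> complex mat) \<Rightarrow> complex mat" where
  "diffusion_op_hat G S \<alpha>\<^sub>0 F \<rho> =
     (of_nat (card S) + of_real \<alpha>\<^sub>0) \<cdot>\<^sub>m F \<rho>
       - finsum (cmat_ring (rep_dim G \<rho>)) (\<lambda>g. \<rho> g * F \<rho>) S"

text \<open>
  Functions on a set \<open>R\<close> of representations with \<open>F \<rho>\<close> a square matrix of size the dimension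
  of \<open>\<rho>\<close>. Values outside \<open>R\<close> are irrelevant, so an eigenfunction must be nonzero somewhere on
  \<open>R\<close> and satisfies the eigenvalue equation at every point of \<open>R\<close>.
\<close>

definition matrix_functions ::
  "('g, 'm) monoid_scheme \<Rightarrow> ('g \<Rightarrow> complex mat) set
     \<Rightarrow> (('g \<Rightarrow> complex mat) \<Rightarrow> complex mat) set" where
  "matrix_functions G R = (\<Pi> \<rho>\<in>R. carrier_mat (rep_dim G \<rho>) (rep_dim G \<rho>))"

definition eigenfunction ::
  "('g, 'm) monoid_scheme \<Rightarrow> ('g \<Rightarrow> complex mat) set \<Rightarrow>
     ((('g \<Rightarrow> complex mat) \<Rightarrow> complex mat) \<Rightarrow> ('g \<Rightarrow> complex mat) \<Rightarrow> complex mat) \<Rightarrow>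
     (('g \<Rightarrow> complex mat) \<Rightarrow> complex mat) \<Rightarrow> complex \<Rightarrow> bool" where
  "eigenfunction G R A F c \<longleftrightarrow> F \<in> matrix_functions G R \<and>
     (\<exists>\<rho>\<in>R. F \<rho> \<noteq> 0\<^sub>m (rep_dim G \<rho>) (rep_dim G \<rho>)) \<and>
     (\<forall>\<rho>\<in>R. A F \<rho> = c \<cdot>\<^sub>m F \<rho>)"

definition single_column_mat :: "nat \<Rightarrow> nat \<Rightarrow> complex vec \<Rightarrow> complex mat" where
  "single_column_mat d k v = mat d d (\<lambda>(a, b). if b = k then v $ a else 0)"

definition column_function ::
  "('g, 'm) monoid_scheme \<Rightarrow> ('g \<Rightarrow> complex mat) \<Rightarrow> nat \<Rightarrow> complex vec
     \<Rightarrow> ('g \<Rightarrow> complex mat) \<Rightarrow> complex mat" where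
  "column_function G \<sigma> k v = (\<lambda>\<rho>. if \<rho> = \<sigma> then single_column_mat (rep_dim G \<sigma>) k v
                                   else 0\<^sub>m (rep_dim G \<rho>) (rep_dim G \<rho>))"

lemma representationD:
  assumes "representation G \<rho>"
  shows "\<And>g. g \<in> carrier G \<Longrightarrow> \<rho> g \<in> carrier_mat (rep_dim G \<rho>) (rep_dim G \<rho>)"
    and "\<And>g h. g \<in> carrier G \<Longrightarrow> h \<in> carrier G \<Longrightarrow> \<rho> (g \<otimes>\<^bsub>G\<^esub> h) = \<rho> g * \<rho> h"
  using assms
  by (auto simp: representation_def hom_def units_of_def Units_def ring_mat_simps Pi_iff)

lemma finsum_cmat:
  assumes "finite A" and "\<And>x. x \<in> A \<Longrightarrow> f x \<in> carrier_mat d d"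
  shows "finsum (cmat_ring d) f A \<in> carrier_mat d d \<and>
    (\<forall>a<d. \<forall>b<d. finsum (cmat_ring d) f A $$ (a, b) = (\<Sum>x\<in>A. f x $$ (a, b)))"
proof -
  interpret ring "cmat_ring d" by (rule ring_mat)
  show ?thesis
    using assms
  proof (induction A rule: finite_induct)
    case empty
    then show ?case by (simp add: ring_mat_simps)
  next
    case (insert x A)
    have "finsum (cmat_ring d) f (insert x A) = f x + finsum (cmat_ring d) f A"
      using insert finsum_insert[of A x f] by (auto simp: ring_mat_simps)
    with insert show ?case by auto
  qed
qed

lemma diffusion_op_eq:
  assumes "group G" "finite (carrier G)" "S \<subseteq> carrier G" "g \<in> carrier G"
  shows "diffusion_op G S \<alpha>\<^sub>0 f g =
    (of_nat (card S) + of_real \<alpha>\<^sub>0) * f g - (\<Sum>s\<in>S. f (inv\<^bsub>G\<^esub> s \<otimes>\<^bsub>G\<^esub> g))"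
proof -
  interpret group G by fact
  let ?c = "of_nat (card S) + of_real \<alpha>\<^sub>0 :: complex"
  have bij: "bij_betw (\<lambda>r. inv\<^bsub>G\<^esub> r) (carrier G) (carrier G)"
    by (rule bij_betw_byWitness[where f' = "\<lambda>r. inv\<^bsub>G\<^esub> r"]) auto
  have "diffusion_op G S \<alpha>\<^sub>0 f g =
    (\<Sum>r\<in>carrier G. (?c * indicator {\<one>\<^bsub>G\<^esub>} r - indicator S r) * f (inv\<^bsub>G\<^esub> r \<otimes>\<^bsub>G\<^esub> g))"
    unfolding diffusion_op_def convolution_def
    by (subst sum.reindex_bij_betw[OF bij, symmetric]) (auto intro!: sum.cong)
  also have "\<dots> = (\<Sum>r\<in>carrier G. if r = \<one>\<^bsub>G\<^esub> then ?c * f g else 0)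
     - (\<Sum>r\<in>carrier G. if r \<in> S then f (inv\<^bsub>G\<^esub> r \<otimes>\<^bsub>G\<^esub> g) else 0)"
    unfolding sum_subtractf[symmetric]
    using assms(4) by (intro sum.cong) (auto simp: algebra_simps)
  also have "\<dots> = ?c * f g - (\<Sum>s\<in>S. f (inv\<^bsub>G\<^esub> s \<otimes>\<^bsub>G\<^esub> g))"
    using assms(2,3) by (simp add: sum.If_cases Int_absorb1)
  finally show ?thesis .
qed

lemma fourier_transform_diffusion_op:
  assumes G: "group G" and fin: "finite (carrier G)" and S: "S \<subseteq> carrier G"
    and rep: "representation G \<rho>"
  shows "fourier_transform G (diffusion_op G S \<alpha>\<^sub>0 f) \<rho>
    = diffusion_op_hat G S \<alpha>\<^sub>0 (fourier_transform G f) \<rho>"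
proof -
  interpret group G by fact
  let ?d = "rep_dim G \<rho>"
  let ?c = "of_nat (card S) + of_real \<alpha>\<^sub>0 :: complex"
  note \<rho> = representationD[OF rep]
  have finS: "finite S" using S fin by (rule finite_subset)
  have F: "fourier_transform G h \<rho> \<in> carrier_mat ?d ?d"
    "\<And>a b. a < ?d \<Longrightarrow> b < ?d \<Longrightarrow>
       fourier_transform G h \<rho> $$ (a, b) = (\<Sum>g\<in>carrier G. h g * \<rho> g $$ (a, b))" for h
  proof -
    have *: "fourier_transform G h \<rho> \<in> carrier_mat ?d ?d \<and>
      (\<forall>a<?d. \<forall>b<?d. fourier_transform G h \<rho> $$ (a, b)
         = (\<Sum>g\<in>carrier G. (h g \<cdot>\<^sub>m \<rho> g) $$ (a, b)))"
      unfolding fourier_transform_def by (rule finsum_cmat[OF fin]) (use \<rho> in auto)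
    then show "fourier_transform G h \<rho> \<in> carrier_mat ?d ?d" by blast
    fix a b assume ab: "a < ?d" "b < ?d"
    with * have "fourier_transform G h \<rho> $$ (a, b)
         = (\<Sum>g\<in>carrier G. (h g \<cdot>\<^sub>m \<rho> g) $$ (a, b))" by blast
    also have "\<dots> = (\<Sum>g\<in>carrier G. h g * \<rho> g $$ (a, b))"
      using \<rho>(1)[THEN carrier_matD(1)] \<rho>(1)[THEN carrier_matD(2)] ab
      by (intro sum.cong) auto
    finally show "fourier_transform G h \<rho> $$ (a, b) = (\<Sum>g\<in>carrier G. h g * \<rho> g $$ (a, b))" .
  qed
  let ?F = "fourier_transform G f \<rho>"
  have P: "finsum (cmat_ring ?d) (\<lambda>g. \<rho> g * ?F) S \<in> carrier_mat ?d ?d \<and>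
    (\<forall>a<?d. \<forall>b<?d. finsum (cmat_ring ?d) (\<lambda>g. \<rho> g * ?F) S $$ (a, b)
       = (\<Sum>s\<in>S. (\<rho> s * ?F) $$ (a, b)))"
    by (rule finsum_cmat[OF finS]) (use \<rho> S F(1) in \<open>auto intro!: mult_carrier_mat\<close>)
  have mult_entry: "(\<rho> s * B) $$ (a, b) = (\<Sum>k<?d. \<rho> s $$ (a, k) * B $$ (k, b))"
    if "s \<in> carrier G" "B \<in> carrier_mat ?d ?d" "a < ?d" "b < ?d" for s B a b
    using \<rho>(1)[OF that(1)] that(2-)
    by (auto simp: scalar_prod_def atLeast0LessThan intro!: sum.cong)
  have shift: "(\<Sum>g\<in>carrier G. f (inv\<^bsub>G\<^esub> s \<otimes>\<^bsub>G\<^esub> g) * \<rho> g $$ (a, b)) = (\<rho> s * ?F) $$ (a, b)"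
    if s: "s \<in> S" and ab: "a < ?d" "b < ?d" for s a b
  proof -
    have sG: "s \<in> carrier G" using s S by blast
    have bij: "bij_betw (\<lambda>h. s \<otimes>\<^bsub>G\<^esub> h) (carrier G) (carrier G)"
      by (rule bij_betw_byWitness[where f' = "\<lambda>g. inv\<^bsub>G\<^esub> s \<otimes>\<^bsub>G\<^esub> g"])
        (use sG in \<open>auto simp: m_assoc[symmetric]\<close>)
    have "(\<Sum>g\<in>carrier G. f (inv\<^bsub>G\<^esub> s \<otimes>\<^bsub>G\<^esub> g) * \<rho> g $$ (a, b))
      = (\<Sum>h\<in>carrier G. f h * (\<rho> s * \<rho> h) $$ (a, b))"
      by (subst sum.reindex_bij_betw[OF bij, symmetric])
        (use sG \<rho>(2) in \<open>auto simp: m_assoc[symmetric] intro!: sum.cong\<close>)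
    also have "\<dots> = (\<Sum>h\<in>carrier G. \<Sum>k<?d. \<rho> s $$ (a, k) * (f h * \<rho> h $$ (k, b)))"
      using mult_entry[OF sG \<rho>(1) ab]
      by (intro sum.cong) (auto simp: sum_distrib_left mult_ac)
    also have "\<dots> = (\<Sum>k<?d. \<rho> s $$ (a, k) * ?F $$ (k, b))"
      by (subst sum.swap) (use F(2) ab in \<open>auto simp: sum_distrib_left intro!: sum.cong\<close>)
    also have "\<dots> = (\<rho> s * ?F) $$ (a, b)"
      using mult_entry[OF sG F(1) ab] by simp
    finally show ?thesis .
  qed
  show ?thesis
  proof (rule eq_matI)
    have dims: "diffusion_op_hat G S \<alpha>\<^sub>0 (fourier_transform G f) \<rho> \<in> carrier_mat ?d ?d"
      unfolding diffusion_op_hat_def using P by (auto intro!: minus_carrier_mat)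
    show "dim_row (fourier_transform G (diffusion_op G S \<alpha>\<^sub>0 f) \<rho>)
      = dim_row (diffusion_op_hat G S \<alpha>\<^sub>0 (fourier_transform G f) \<rho>)"
      and "dim_col (fourier_transform G (diffusion_op G S \<alpha>\<^sub>0 f) \<rho>)
      = dim_col (diffusion_op_hat G S \<alpha>\<^sub>0 (fourier_transform G f) \<rho>)"
      using dims F(1)[of "diffusion_op G S \<alpha>\<^sub>0 f"] by auto
    fix a b
    assume "a < dim_row (diffusion_op_hat G S \<alpha>\<^sub>0 (fourier_transform G f) \<rho>)"
      and "b < dim_col (diffusion_op_hat G S \<alpha>\<^sub>0 (fourier_transform G f) \<rho>)"
    with dims have ab: "a < ?d" "b < ?d" by auto
    have "fourier_transform G (diffusion_op G S \<alpha>\<^sub>0 f) \<rho> $$ (a, b)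
      = (\<Sum>g\<in>carrier G. (?c * f g - (\<Sum>s\<in>S. f (inv\<^bsub>G\<^esub> s \<otimes>\<^bsub>G\<^esub> g))) * \<rho> g $$ (a, b))"
      using F(2)[OF ab] diffusion_op_eq[OF G fin S] by (auto intro!: sum.cong)
    also have "\<dots> = ?c * (\<Sum>g\<in>carrier G. f g * \<rho> g $$ (a, b))
      - (\<Sum>g\<in>carrier G. \<Sum>s\<in>S. f (inv\<^bsub>G\<^esub> s \<otimes>\<^bsub>G\<^esub> g) * \<rho> g $$ (a, b))"
      unfolding left_diff_distrib sum_subtractf
      by (simp add: sum_distrib_left sum_distrib_right mult.assoc)
    also have "\<dots> = ?c * ?F $$ (a, b) - (\<Sum>s\<in>S. (\<rho> s * ?F) $$ (a, b))"
      by (subst sum.swap) (use F(2)[OF ab] shift[OF _ ab] in auto)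
    also have "\<dots> = diffusion_op_hat G S \<alpha>\<^sub>0 (fourier_transform G f) \<rho> $$ (a, b)"
      unfolding diffusion_op_hat_def using P F(1)[of f] ab by auto
    finally show "fourier_transform G (diffusion_op G S \<alpha>\<^sub>0 f) \<rho> $$ (a, b)
      = diffusion_op_hat G S \<alpha>\<^sub>0 (fourier_transform G f) \<rho> $$ (a, b)" .
  qed
qed

end

theory Submission
  imports Defs
begin

text \<open>At each representation the operator is left multiplication by the matrix c I - M, where
  c = |S| + \<alpha>_0 and M is \<open>rep_sum\<close> (\<open>diffusion_op_hat_eq_rep_sum\<close>).
  Left multiplication treats the columns of a matrix separately, so a matrix whose only filled
  column is an eigenvector of M for \<nu> is multiplied by c - \<nu>
  (\<open>mult_single_column_mat\<close>, \<open>smult_single_column_mat\<close>). At the other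
  representations the function is zero and the eigenvalue equation is trivial. The function is not
  zero because an eigenvector is not (\<open>single_column_mat_eq_0_iff\<close>).
  \<open>eigenfunction_column_function\<close> combines these facts for a single
  eigenvector.\<close>

lemma rep_sum_carrier:
  assumes "representation G \<rho>" and "finite S" and "S \<subseteq> carrier G"
  shows "rep_sum G S \<rho> \<in> carrier_mat (rep_dim G \<rho>) (rep_dim G \<rho>)"
  unfolding rep_sum_def
  using finsum_cmat[OF assms(2)] representationD(1)[OF assms(1)] assms(3) by blast

text \<open>Distributivity in the matrix ring pulls the common right factor \<open>F \<rho>\<close>
  out of the sum over \<open>S\<close>.\<close>

lemma diffusion_op_hat_eq_rep_sum:
  assumes "representation G \<rho>" and "finite S" and "S \<subseteq> carrier G"
    and "F \<rho> \<in> carrier_mat (rep_dim G \<rho>) (rep_dim G \<rho>)"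
  shows "diffusion_op_hat G S \<alpha>\<^sub>0 F \<rho> =
    (of_nat (card S) + of_real \<alpha>\<^sub>0) \<cdot>\<^sub>m F \<rho> - rep_sum G S \<rho> * F \<rho>"
proof -
  interpret ring "cmat_ring (rep_dim G \<rho>)" by (rule ring_mat)
  have "rep_sum G S \<rho> * F \<rho> = finsum (cmat_ring (rep_dim G \<rho>)) (\<lambda>g. \<rho> g * F \<rho>) S"
    unfolding rep_sum_def
    using finsum_ldistr[of S "F \<rho>" \<rho>] assms representationD(1)[OF assms(1)]
    by (auto simp: ring_mat_simps)
  then show ?thesis
    by (simp add: diffusion_op_hat_def)
qed

lemma single_column_mat_carrier [simp]: "single_column_mat d k v \<in> carrier_mat d d"
  by (simp add: single_column_mat_def)

text \<open>Column \<open>k\<close> carries all of \<open>v\<close>. The bound \<open>k < d\<close>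
  ensures that this column exists; otherwise the matrix would vanish for every
  \<open>v\<close>.\<close>

lemma single_column_mat_eq_0_iff:
  assumes "v \<in> carrier_vec d" and "k < d"
  shows "single_column_mat d k v = 0\<^sub>m d d \<longleftrightarrow> v = 0\<^sub>v d"
proof
  assume *: "single_column_mat d k v = 0\<^sub>m d d"
  show "v = 0\<^sub>v d"
  proof (rule eq_vecI)
    fix a assume "a < dim_vec (0\<^sub>v d :: complex vec)"
    then show "v $ a = 0\<^sub>v d $ a"
      using arg_cong[OF *, of "\<lambda>A. A $$ (a, k)"] assms(2) by (simp add: single_column_mat_def)
  qed (use assms(1) in simp)
qed (auto simp: single_column_mat_def)

text \<open>Each column of a product is \<open>A\<close> applied to the corresponding column of the
  right factor, and zero columns stay zero.\<close>

lemma mult_single_column_mat: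
  assumes "A \<in> carrier_mat d d" and "v \<in> carrier_vec d"
  shows "A * single_column_mat d k v = single_column_mat d k (A *\<^sub>v v)"
  using assms
  by (intro eq_matI) (auto simp: single_column_mat_def scalar_prod_def intro!: sum.cong sum.neutral)

lemma smult_single_column_mat:
  "v \<in> carrier_vec d \<Longrightarrow> single_column_mat d k (c \<cdot>\<^sub>v v) = c \<cdot>\<^sub>m single_column_mat d k v"
  by (intro eq_matI) (auto simp: single_column_mat_def)

lemma eigenfunction_column_function:
  assumes "finite S" and "S \<subseteq> carrier G"
    and rep: "\<And>\<rho>. \<rho> \<in> R \<Longrightarrow> representation G \<rho>" and \<sigma>: "\<sigma> \<in> R"
    and k: "k < rep_dim G \<sigma>" and ev: "eigenvector (rep_sum G S \<sigma>) v \<nu>"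
  shows "eigenfunction G R (diffusion_op_hat G S \<alpha>\<^sub>0) (column_function G \<sigma> k v)
    (of_nat (card S) + of_real \<alpha>\<^sub>0 - \<nu>)"
proof -
  let ?F = "column_function G \<sigma> k v"
  have F: "?F \<rho> \<in> carrier_mat (rep_dim G \<rho>) (rep_dim G \<rho>)" for \<rho>
    by (simp add: column_function_def)
  have v: "v \<in> carrier_vec (rep_dim G \<sigma>)" "v \<noteq> 0\<^sub>v (rep_dim G \<sigma>)"
    "rep_sum G S \<sigma> *\<^sub>v v = \<nu> \<cdot>\<^sub>v v"
    using ev rep_sum_carrier[OF rep[OF \<sigma>] assms(1,2)] by (auto simp: eigenvector_def)
  \<comment> \<open>At \<open>\<sigma>\<close> this is the eigenvector equation placed in column
    \<open>k\<close>; at any other representation both sides are zero matrices.\<close>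
  have M: "rep_sum G S \<rho> * ?F \<rho> = \<nu> \<cdot>\<^sub>m ?F \<rho>" if "\<rho> \<in> R" for \<rho>
    using rep_sum_carrier[OF rep[OF that] assms(1,2)] v
    by (auto simp: column_function_def mult_single_column_mat smult_single_column_mat)
  have "diffusion_op_hat G S \<alpha>\<^sub>0 ?F \<rho> = (of_nat (card S) + of_real \<alpha>\<^sub>0 - \<nu>) \<cdot>\<^sub>m ?F \<rho>"
    if "\<rho> \<in> R" for \<rho>
    unfolding diffusion_op_hat_eq_rep_sum[where F = ?F, OF rep[OF that] assms(1,2) F] M[OF that]
    using F[of \<rho>] by (intro eq_matI) (auto simp: algebra_simps)
  \<comment> \<open>\<open>\<sigma>\<close> is the witness that the function is nonzero somewhere on
    \<open>R\<close>.\<close>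
  moreover have "?F \<sigma> \<noteq> 0\<^sub>m (rep_dim G \<sigma>) (rep_dim G \<sigma>)"
    using v k by (simp add: column_function_def single_column_mat_eq_0_iff)
  ultimately show ?thesis
    using F \<sigma> by (auto simp: eigenfunction_def matrix_functions_def)
qed

theorem proposition10:
  fixes G :: "('g, 'm) monoid_scheme"
    and S :: "'g set"
    and \<alpha>\<^sub>0 :: real
    and L :: nat
    and \<rho> :: "nat \<Rightarrow> 'g \<Rightarrow> complex mat"
    and v :: "nat \<Rightarrow> nat \<Rightarrow> complex vec"
    and \<nu> :: "nat \<Rightarrow> nat \<Rightarrow> complex"
  assumes "group G" and "finite (carrier G)"
    and "symmetric_subset G S"
    and "\<alpha>\<^sub>0 > 0"
    and "maximal_inequivalent_irreps G (\<rho> ` {..<L})" and "inj_on \<rho> {..<L}"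
    and "\<And>i j. i < L \<Longrightarrow> j < rep_dim G (\<rho> i) \<Longrightarrow>
           eigenvector (rep_sum G S (\<rho> i)) (v i j) (\<nu> i j)"
    and "\<And>i. i < L \<Longrightarrow> inj_on (v i) {..<rep_dim G (\<rho> i)}"
    and "\<And>i. i < L \<Longrightarrow>
           vectorspace.basis class_ring (module_vec TYPE(complex) (rep_dim G (\<rho> i)))
             (v i ` {..<rep_dim G (\<rho> i)})"
  shows "\<forall>i<L. \<forall>j<rep_dim G (\<rho> i). \<forall>k<rep_dim G (\<rho> i).
           eigenfunction G (\<rho> ` {..<L}) (diffusion_op_hat G S \<alpha>\<^sub>0)
             (column_function G (\<rho> i) k (v i j))
             (of_nat (card S) + of_real \<alpha>\<^sub>0 - \<nu> i j)"
proof (intro allI impI)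
  fix i j k
  assume i: "i < L" and j: "j < rep_dim G (\<rho> i)" and k: "k < rep_dim G (\<rho> i)"
  have S: "S \<subseteq> carrier G" "finite S"
    using assms(2,3) by (auto simp: symmetric_subset_def intro: finite_subset)
  \<comment> \<open>The eigenvalue equation has to hold at every member of the family, so each must
    be known to have square matrices as values.\<close>
  have "\<And>\<sigma>. \<sigma> \<in> \<rho> ` {..<L} \<Longrightarrow> representation G \<sigma>"
    using assms(5)
    by (auto simp: maximal_inequivalent_irreps_def inequivalent_irreps_def irreducible_rep_def)
  then show "eigenfunction G (\<rho> ` {..<L}) (diffusion_op_hat G S \<alpha>\<^sub>0)
      (column_function G (\<rho> i) k (v i j)) (of_nat (card S) + of_real \<alpha>\<^sub>0 - \<nu> i j)"
    using i by (intro eigenfunction_column_function S k assms(7) j) auto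
qed

end
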